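(* (Cayley–Hamilton) Let $\mathcal{A}$ be a sheaf of unital commutative $\mathbb{C}$-algebras on a topological space $X$, let $\mathcal{E}$ be a vector sheaf of rank $n$ on $X$ and let $\varphi:\mathcal{E}\to\mathcal{E}$ be an $\mathcal{A}$-morphism. Then $$P_\varphi(\varphi)\equiv\bigl(P_{\varphi_U}(\varphi_U)\bigr)=(0_U)\equiv 0,$$ that is, for every local gauge $U$ of $\mathcal{E}$, $P_{\varphi_U}(\varphi_U)$ is the zero endomorphism of the $\mathcal{A}(U)$-module $\mathcal{E}(U)$.
   Context: A vector sheaf of rank $n$ is a locally free $\mathcal{A}$-module of rank $n$; a local gauge of $\mathcal{E}$ is an open $U\subseteq X$ such that $\mathcal{E}|_U\cong\mathcal{A}^n|_U$ as $\mathcal{A}|_U$-modules. On a local gauge $U$, let $\{e_i^U\}_{1\le i\le n}$ be the basis of $\mathcal{E}(U)$ corresponding to the canonical (Kronecker) basis of $\mathcal{A}^n(U)=\mathcal{A}(U)^n$, and let $M_U\in M_n(\mathcal{A}(U))$ be the matrix representing $\varphi_U:\mathcal{E}(U)\to\mathcal{E}(U)$ (the map induced by $\varphi$ on sections) in this basis. The characteristic polynomial of $\varphi_U$ is $P_{\varphi_U}(t)=\det(tI_U-M_U)\in\mathcal{A}(U)[t]$, with $I_U$ the $n\times n$ identity matrix over $\mathcal{A}(U)$, and $P_\varphi(t)\equiv(P_{\varphi_U}(t))$. For a polynomial $f\in\mathcal{A}(U)[t]$, $f(\varphi_U)$ is the $\mathcal{A}(U)$-endomorphism of $\mathcal{E}(U)$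 obtained by substituting $\varphi_U$ for $t$. *)

theory Defs
  imports
    Complex_Main
    "HOL-Analysis.Abstract_Topology"
    "HOL-Combinatorics.Permutations"
    "HOL-Algebra.UnivPoly"
begin

section \<open>Linear algebra over a commutative ring given by its carrier\<close>

definition mod_hom ::
  "('a, 'r) ring_scheme \<Rightarrow> ('a, 'b, 'm) module_scheme \<Rightarrow> ('a, 'c, 'n) module_scheme \<Rightarrow> ('b \<Rightarrow> 'c) set"
  where "mod_hom R M N =
    {f \<in> carrier M \<rightarrow> carrier N.
       (\<forall>x\<in>carrier M. \<forall>y\<in>carrier M. f (x \<oplus>\<^bsub>M\<^esub> y) = f x \<oplus>\<^bsub>N\<^esub> f y) \<and>
       (\<forall>a\<in>carrier R. \<forall>x\<in>carrier M. f (a \<odot>\<^bsub>M\<^esub> x) = a \<odot>\<^bsub>N\<^esub> f x)}"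

text \<open>Endomorphisms are taken to be extensional, i.e. undefined outside the carrier, so that
  equality in this ring is equality of maps on the module.\<close>

definition end_ring ::
  "('a, 'r) ring_scheme \<Rightarrow> ('a, 'b, 'm) module_scheme \<Rightarrow> ('b \<Rightarrow> 'b) ring"
  where "end_ring R M =
    \<lparr>carrier = mod_hom R M M \<inter> extensional (carrier M),
     monoid.mult = compose (carrier M),
     monoid.one = (\<lambda>x\<in>carrier M. x),
     zero = (\<lambda>x\<in>carrier M. \<zero>\<^bsub>M\<^esub>),
     add = (\<lambda>f g. \<lambda>x\<in>carrier M. f x \<oplus>\<^bsub>M\<^esub> g x)\<rparr>"

text \<open>The module \<open>R\<^sup>n\<close>; the multiplicative fields of the record play no role for modules.\<close>

definition free_module :: "('a, 'r) ring_scheme \<Rightarrow> nat \<Rightarrow> ('a, nat \<Rightarrow> 'a) module"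
  where "free_module R n =
    \<lparr>carrier = {..<n} \<rightarrow>\<^sub>E carrier R,
     monoid.mult = undefined,
     monoid.one = undefined,
     zero = (\<lambda>i\<in>{..<n}. \<zero>\<^bsub>R\<^esub>),
     add = (\<lambda>v w. \<lambda>i\<in>{..<n}. v i \<oplus>\<^bsub>R\<^esub> w i),
     module.smult = (\<lambda>a v. \<lambda>i\<in>{..<n}. a \<otimes>\<^bsub>R\<^esub> v i)\<rparr>"

definition kronecker :: "('a, 'r) ring_scheme \<Rightarrow> nat \<Rightarrow> nat \<Rightarrow> nat \<Rightarrow> 'a"
  where "kronecker R n i = (\<lambda>j\<in>{..<n}. if j = i then \<one>\<^bsub>R\<^esub> else \<zero>\<^bsub>R\<^esub>)"

definition is_basis ::
  "('a, 'r) ring_scheme \<Rightarrow> ('a, 'b, 'm) module_scheme \<Rightarrow> nat \<Rightarrow> (nat \<Rightarrow> 'b) \<Rightarrow> bool"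
  where "is_basis R M n b \<longleftrightarrow>
    b \<in> {..<n} \<rightarrow> carrier M \<and>
    (\<forall>x\<in>carrier M. \<exists>!c. c \<in> {..<n} \<rightarrow>\<^sub>E carrier R \<and> x = (\<Oplus>\<^bsub>M\<^esub>i\<in>{..<n}. c i \<odot>\<^bsub>M\<^esub> b i))"

text \<open>Meaningful when \<open>b\<close> is a basis.\<close>

definition coords ::
  "('a, 'r) ring_scheme \<Rightarrow> ('a, 'b, 'm) module_scheme \<Rightarrow> nat \<Rightarrow> (nat \<Rightarrow> 'b) \<Rightarrow> 'b \<Rightarrow> nat \<Rightarrow> 'a"
  where "coords R M n b x =
    (THE c. c \<in> {..<n} \<rightarrow>\<^sub>E carrier R \<and> x = (\<Oplus>\<^bsub>M\<^esub>i\<in>{..<n}. c i \<odot>\<^bsub>M\<^esub> b i))"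

text \<open>An \<open>n \<times> n\<close> matrix is a function of row and column index, of which only the values at
  indices below \<open>n\<close> are relevant. Column \<open>j\<close> holds the coordinates of \<open>f (b j)\<close>.\<close>

definition rep_matrix ::
  "('a, 'r) ring_scheme \<Rightarrow> ('a, 'b, 'm) module_scheme \<Rightarrow> nat \<Rightarrow> (nat \<Rightarrow> 'b) \<Rightarrow> ('b \<Rightarrow> 'b)
     \<Rightarrow> nat \<Rightarrow> nat \<Rightarrow> 'a"
  where "rep_matrix R M n b f i j = coords R M n b (f (b j)) i"

definition ring_det :: "('a, 'r) ring_scheme \<Rightarrow> nat \<Rightarrow> (nat \<Rightarrow> nat \<Rightarrow> 'a) \<Rightarrow> 'a"
  where "ring_det R n A =
    (\<Oplus>\<^bsub>R\<^esub>p\<in>{p. p permutes {..<n}}. [(sign p :: int)] \<cdot>\<^bsub>R\<^esub> (\<Otimes>\<^bsub>R\<^esub>i\<in>{..<n}. A i (p i)))"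

text \<open>\<open>monom (UP R) \<one>\<^bsub>R\<^esub> 1\<close> is the indeterminate and \<open>monom (UP R) a 0\<close> the constant \<open>a\<close>.\<close>

definition charpoly :: "('a, 'r) ring_scheme \<Rightarrow> nat \<Rightarrow> (nat \<Rightarrow> nat \<Rightarrow> 'a) \<Rightarrow> nat \<Rightarrow> 'a"
  where "charpoly R n A =
    ring_det (UP R) n (\<lambda>i j.
      (if i = j then up_ring.monom (UP R) \<one>\<^bsub>R\<^esub> 1 else \<zero>\<^bsub>UP R\<^esub>) \<ominus>\<^bsub>UP R\<^esub> up_ring.monom (UP R) (A i j) 0)"

text \<open>\<open>UnivPoly.eval\<close> only takes the structure map and the ring operations of its target, so it
  also serves for the noncommutative target \<open>end_ring R M\<close>.\<close>

definition poly_at_endo ::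
  "('a, 'r) ring_scheme \<Rightarrow> ('a, 'b, 'm) module_scheme \<Rightarrow> (nat \<Rightarrow> 'a) \<Rightarrow> ('b \<Rightarrow> 'b) \<Rightarrow> ('b \<Rightarrow> 'b)"
  where "poly_at_endo R M p f =
    UnivPoly.eval R (end_ring R M) (\<lambda>a. \<lambda>x\<in>carrier M. a \<odot>\<^bsub>M\<^esub> x) (restrict f (carrier M)) p"

lemma mod_homD:
  assumes "f \<in> mod_hom R M N"
  shows "x \<in> carrier M \<Longrightarrow> f x \<in> carrier N"
    and "\<lbrakk>x \<in> carrier M; y \<in> carrier M\<rbrakk> \<Longrightarrow> f (x \<oplus>\<^bsub>M\<^esub> y) = f x \<oplus>\<^bsub>N\<^esub> f y"
    and "\<lbrakk>a \<in> carrier R; x \<in> carrier M\<rbrakk> \<Longrightarrow> f (a \<odot>\<^bsub>M\<^esub> x) = a \<odot>\<^bsub>N\<^esub> f x"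
  using assms by (auto simp: mod_hom_def)

lemma ring_end_ring:
  assumes "Module.module R M"
  shows "ring (end_ring R M)"
proof -
  interpret Module.module R M by fact
  have zero: "(\<lambda>x\<in>carrier M. \<zero>\<^bsub>M\<^esub>) \<in> mod_hom R M M"
    by (auto simp: mod_hom_def)
  have neg: "(\<lambda>x\<in>carrier M. \<ominus>\<^bsub>M\<^esub> f x) \<in> mod_hom R M M" if "f \<in> mod_hom R M M" for f
    using mod_homD[OF that] by (auto simp: mod_hom_def M.minus_add smult_r_minus)
  have add: "(\<lambda>x\<in>carrier M. f x \<oplus>\<^bsub>M\<^esub> g x) \<in> mod_hom R M M"
    if "f \<in> mod_hom R M M" "g \<in> mod_hom R M M" for f g
    using mod_homD[OF that(1)] mod_homD[OF that(2)]
    by (auto simp: mod_hom_def smult_r_distr M.a_ac)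
  have comp: "compose (carrier M) f g \<in> mod_hom R M M"
    if "f \<in> mod_hom R M M" "g \<in> mod_hom R M M" for f g
    using mod_homD[OF that(1)] mod_homD[OF that(2)]
    by (auto simp: mod_hom_def compose_def)
  have id: "(\<lambda>x\<in>carrier M. x) \<in> mod_hom R M M"
    by (auto simp: mod_hom_def)
  let ?E = "end_ring R M"
  have eqI: "f = g"
    if "f \<in> carrier ?E" "g \<in> carrier ?E" "\<And>x. x \<in> carrier M \<Longrightarrow> f x = g x" for f g
    using that by (auto simp: end_ring_def intro: extensionalityI[of f "carrier M" g])
  have E: "f x \<in> carrier M" "f (x \<oplus>\<^bsub>M\<^esub> y) = f x \<oplus>\<^bsub>M\<^esub> f y"
    if "f \<in> carrier ?E" "x \<in> carrier M" "y \<in> carrier M" for f x y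
    using that by (auto simp: end_ring_def mod_hom_def)
  have closed: "\<zero>\<^bsub>?E\<^esub> \<in> carrier ?E" "\<one>\<^bsub>?E\<^esub> \<in> carrier ?E"
    "\<And>f. f \<in> carrier ?E \<Longrightarrow> (\<lambda>x\<in>carrier M. \<ominus>\<^bsub>M\<^esub> f x) \<in> carrier ?E"
    "\<And>f g. \<lbrakk>f \<in> carrier ?E; g \<in> carrier ?E\<rbrakk> \<Longrightarrow> f \<oplus>\<^bsub>?E\<^esub> g \<in> carrier ?E"
    "\<And>f g. \<lbrakk>f \<in> carrier ?E; g \<in> carrier ?E\<rbrakk> \<Longrightarrow> f \<otimes>\<^bsub>?E\<^esub> g \<in> carrier ?E"
    by (simp_all add: end_ring_def zero id add comp neg)
  have app: "\<zero>\<^bsub>?E\<^esub> x = \<zero>\<^bsub>M\<^esub>" "\<one>\<^bsub>?E\<^esub> x = x" "(f \<oplus>\<^bsub>?E\<^esub> g) x = f x \<oplus>\<^bsub>M\<^esub> g x"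
    "(f \<otimes>\<^bsub>?E\<^esub> g) x = f (g x)" if "x \<in> carrier M" for f g x
    using that by (simp_all add: end_ring_def compose_def)
  show ?thesis
  proof (rule ringI)
    show "abelian_group ?E"
    proof (rule abelian_groupI)
      fix f assume f: "f \<in> carrier ?E"
      have "(\<lambda>x\<in>carrier M. \<ominus>\<^bsub>M\<^esub> f x) \<oplus>\<^bsub>?E\<^esub> f = \<zero>\<^bsub>?E\<^esub>"
        by (rule eqI) (simp_all add: f closed app E M.l_neg)
      then show "\<exists>g\<in>carrier ?E. g \<oplus>\<^bsub>?E\<^esub> f = \<zero>\<^bsub>?E\<^esub>"
        using closed(3)[OF f] by blast
    qed (simp_all add: closed, (rule eqI; simp add: closed app E M.a_ac)+)
    show "Group.monoid ?E"
      by (rule monoidI) (simp_all add: closed, (rule eqI; simp add: closed app E)+)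
  qed (rule eqI; simp add: closed app E)+
qed

lemma module_free_module:
  assumes "cring R"
  shows "Module.module R (free_module R n)"
proof -
  interpret cring R by fact
  let ?F = "free_module R n"
  have eqI: "v = w" if "v \<in> carrier ?F" "w \<in> carrier ?F" "\<And>i. i < n \<Longrightarrow> v i = w i" for v w
    using that by (auto simp: free_module_def PiE_iff intro: extensionalityI[of v "{..<n}" w])
  have F: "v i \<in> carrier R" if "v \<in> carrier ?F" "i < n" for v i
    using that by (auto simp: free_module_def PiE_iff)
  have closed: "\<zero>\<^bsub>?F\<^esub> \<in> carrier ?F"
    "\<And>v w. \<lbrakk>v \<in> carrier ?F; w \<in> carrier ?F\<rbrakk> \<Longrightarrow> v \<oplus>\<^bsub>?F\<^esub> w \<in> carrier ?F"
    "\<And>a v. \<lbrakk>a \<in> carrier R; v \<in> carrier ?F\<rbrakk> \<Longrightarrow> a \<odot>\<^bsub>?F\<^esub> v \<in> carrier ?F"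
    by (auto simp: free_module_def PiE_iff)
  have app: "\<zero>\<^bsub>?F\<^esub> i = \<zero>\<^bsub>R\<^esub>" "(v \<oplus>\<^bsub>?F\<^esub> w) i = v i \<oplus>\<^bsub>R\<^esub> w i"
    "(a \<odot>\<^bsub>?F\<^esub> v) i = a \<otimes>\<^bsub>R\<^esub> v i" if "i < n" for a v w i
    using that by (simp_all add: free_module_def)
  show ?thesis
  proof (rule moduleI)
    show "abelian_group ?F"
    proof (rule abelian_groupI)
      fix v assume v: "v \<in> carrier ?F"
      have n: "(\<lambda>i\<in>{..<n}. \<ominus>\<^bsub>R\<^esub> v i) \<in> carrier ?F"
        using F[OF v] by (auto simp: free_module_def)
      have "(\<lambda>i\<in>{..<n}. \<ominus>\<^bsub>R\<^esub> v i) \<oplus>\<^bsub>?F\<^esub> v = \<zero>\<^bsub>?F\<^esub>"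
        by (rule eqI) (simp_all add: v n closed app F l_neg)
      then show "\<exists>w\<in>carrier ?F. w \<oplus>\<^bsub>?F\<^esub> v = \<zero>\<^bsub>?F\<^esub>"
        using n by blast
    qed (simp_all add: closed, (rule eqI; simp add: closed app F a_ac)+)
  qed (simp_all add: assms closed,
      (rule eqI; simp add: closed app F l_distr r_distr m_assoc)+)
qed

lemma finsum_free_module:
  assumes "cring R" "finite S" "f \<in> S \<rightarrow> carrier (free_module R n)" "j < n"
  shows "(\<Oplus>\<^bsub>free_module R n\<^esub>i\<in>S. f i) j = (\<Oplus>\<^bsub>R\<^esub>i\<in>S. f i j)"
proof -
  interpret cring R by fact
  interpret F: Module.module R "free_module R n" by (rule module_free_module) fact
  show ?thesis
    using assms(2,3)
  proof (induction S)
    case empty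
    then show ?case using assms(4) by simp (simp add: free_module_def)
  next
    case (insert x S)
    have "(\<lambda>i. f i j) \<in> insert x S \<rightarrow> carrier R"
      using insert.prems assms(4) by (auto simp: free_module_def Pi_iff PiE_iff)
    then show ?case
      using insert assms(4) F.finsum_insert[of S x f] finsum_insert[of S x "\<lambda>i. f i j"]
      by (auto simp: Pi_iff) (simp add: free_module_def)
  qed
qed

lemma finsum_kronecker:
  assumes "cring R" "c \<in> {..<n} \<rightarrow>\<^sub>E carrier R"
  shows "(\<Oplus>\<^bsub>free_module R n\<^esub>i\<in>{..<n}. c i \<odot>\<^bsub>free_module R n\<^esub> kronecker R n i) = c"
proof -
  interpret cring R by fact
  interpret F: Module.module R "free_module R n" by (rule module_free_module) fact
  have k: "kronecker R n i \<in> carrier (free_module R n)" for i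
    by (auto simp: free_module_def kronecker_def)
  have c: "c i \<in> carrier R" if "i < n" for i
    using assms(2) that by (auto simp: PiE_iff)
  have s: "(\<lambda>i. c i \<odot>\<^bsub>free_module R n\<^esub> kronecker R n i) \<in> {..<n} \<rightarrow> carrier (free_module R n)"
    using k c by auto
  show ?thesis
  proof (rule extensionalityI[of _ "{..<n}"])
    show "(\<Oplus>\<^bsub>free_module R n\<^esub>i\<in>{..<n}. c i \<odot>\<^bsub>free_module R n\<^esub> kronecker R n i) \<in> extensional {..<n}"
      using F.finsum_closed[OF s] by (simp add: free_module_def PiE_iff)
    show "c \<in> extensional {..<n}" using assms(2) by (simp add: PiE_iff)
    fix j assume "j \<in> {..<n}"
    then have j: "j < n" by simp
    have "(\<Oplus>\<^bsub>free_module R n\<^esub>i\<in>{..<n}. c i \<odot>\<^bsub>free_module R n\<^esub> kronecker R n i) j =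
        (\<Oplus>\<^bsub>R\<^esub>i\<in>{..<n}. (c i \<odot>\<^bsub>free_module R n\<^esub> kronecker R n i) j)"
      by (rule finsum_free_module[OF assms(1) _ s j]) simp
    also have "\<dots> = (\<Oplus>\<^bsub>R\<^esub>i\<in>{..<n}. if j = i then c i else \<zero>\<^bsub>R\<^esub>)"
      using c j by (intro finsum_cong') (auto simp: free_module_def kronecker_def)
    also have "\<dots> = c j"
      using c j by (intro finsum_singleton) auto
    finally show "(\<Oplus>\<^bsub>free_module R n\<^esub>i\<in>{..<n}. c i \<odot>\<^bsub>free_module R n\<^esub> kronecker R n i) j = c j" .
  qed
qed


section \<open>Sheaves\<close>

text \<open>A presheaf is given by its sections \<open>F U\<close> and restriction maps \<open>\<rho> U V\<close> from \<open>F U\<close> to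
  \<open>F V\<close>; the values at sets which are not open, or at \<open>\<rho> U V\<close> with \<open>V\<close> not contained in \<open>U\<close>,
  are irrelevant.\<close>

locale sheaf_of_sets =
  fixes X :: "'x topology" and F :: "'x set \<Rightarrow> 's set" and \<rho> :: "'x set \<Rightarrow> 'x set \<Rightarrow> 's \<Rightarrow> 's"
  assumes res_closed:
      "\<lbrakk>openin X U; openin X V; V \<subseteq> U\<rbrakk> \<Longrightarrow> \<rho> U V \<in> F U \<rightarrow> F V"
    and res_id:
      "\<lbrakk>openin X U; s \<in> F U\<rbrakk> \<Longrightarrow> \<rho> U U s = s"
    and res_comp:
      "\<lbrakk>openin X U; openin X V; openin X W; W \<subseteq> V; V \<subseteq> U; s \<in> F U\<rbrakk> \<Longrightarrow> \<rho> V W (\<rho> U V s) = \<rho> U W s"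
    and locality:
      "\<lbrakk>\<And>V. V \<in> \<C> \<Longrightarrow> openin X V; s \<in> F (\<Union>\<C>); t \<in> F (\<Union>\<C>);
        \<And>V. V \<in> \<C> \<Longrightarrow> \<rho> (\<Union>\<C>) V s = \<rho> (\<Union>\<C>) V t\<rbrakk> \<Longrightarrow> s = t"
    and gluing:
      "\<lbrakk>\<And>V. V \<in> \<C> \<Longrightarrow> openin X V; \<And>V. V \<in> \<C> \<Longrightarrow> f V \<in> F V;
        \<And>V W. \<lbrakk>V \<in> \<C>; W \<in> \<C>\<rbrakk> \<Longrightarrow> \<rho> V (V \<inter> W) (f V) = \<rho> W (V \<inter> W) (f W)\<rbrakk>
        \<Longrightarrow> \<exists>s\<in>F (\<Union>\<C>). \<forall>V\<in>\<C>. \<rho> (\<Union>\<C>) V s = f V"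

definition complex_field :: "complex ring"
  where "complex_field = \<lparr>carrier = UNIV, monoid.mult = (*), one = 1, zero = 0, add = (+)\<rparr>"

lemma field_complex_field: "field complex_field"
proof -
  have cring: "cring complex_field"
  proof (rule cringI)
    show "abelian_group complex_field"
    proof (rule abelian_groupI)
      fix x assume "x \<in> carrier complex_field"
      show "\<exists>y\<in>carrier complex_field. y \<oplus>\<^bsub>complex_field\<^esub> x = \<zero>\<^bsub>complex_field\<^esub>"
        by (rule bexI[of _ "-x"]) (simp_all add: complex_field_def)
    qed (simp_all add: complex_field_def)
    show "Group.comm_monoid complex_field"
      by (rule comm_monoidI) (simp_all add: complex_field_def)
  qed (simp add: complex_field_def distrib_right)
  then show ?thesis
  proof (rule cring.cring_fieldI)
    have "\<exists>y. y * x = 1 \<and> x * y = 1" if "x \<noteq> 0" for x :: complex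
      by (rule exI[of _ "inverse x"]) (use that in simp)
    then show "Units complex_field = carrier complex_field - {\<zero>\<^bsub>complex_field\<^esub>}"
      by (auto simp: Units_def complex_field_def)
  qed
qed

text \<open>HOL-Algebra's \<open>algebra\<close> is that of unital commutative algebras.\<close>

locale sheaf_of_algebras =
  sheaf_of_sets X "\<lambda>U. carrier (A U)" \<rho>
  for X :: "'x topology" and A :: "'x set \<Rightarrow> (complex, 'a) module"
    and \<rho> :: "'x set \<Rightarrow> 'x set \<Rightarrow> 'a \<Rightarrow> 'a" +
  assumes algebra_sections:
      "openin X U \<Longrightarrow> Module.algebra complex_field (A U)"
    and res_ring_hom:
      "\<lbrakk>openin X U; openin X V; V \<subseteq> U\<rbrakk> \<Longrightarrow> \<rho> U V \<in> ring_hom (A U) (A V)"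
    and res_complex_linear:
      "\<lbrakk>openin X U; openin X V; V \<subseteq> U\<rbrakk> \<Longrightarrow> \<rho> U V \<in> mod_hom complex_field (A U) (A V)"

locale sheaf_of_modules =
  algebras: sheaf_of_algebras X A \<rho> +
  sheaf_of_sets X "\<lambda>U. carrier (E U)" \<sigma>
  for X :: "'x topology" and A :: "'x set \<Rightarrow> (complex, 'a) module"
    and \<rho> :: "'x set \<Rightarrow> 'x set \<Rightarrow> 'a \<Rightarrow> 'a"
    and E :: "'x set \<Rightarrow> ('a, 'e) module"
    and \<sigma> :: "'x set \<Rightarrow> 'x set \<Rightarrow> 'e \<Rightarrow> 'e" +
  assumes module_sections:
      "openin X U \<Longrightarrow> Module.module (A U) (E U)"
    and res_add:
      "\<lbrakk>openin X U; openin X V; V \<subseteq> U; x \<in> carrier (E U); y \<in> carrier (E U)\<rbrakk>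
        \<Longrightarrow> \<sigma> U V (x \<oplus>\<^bsub>E U\<^esub> y) = \<sigma> U V x \<oplus>\<^bsub>E V\<^esub> \<sigma> U V y"
    and res_smult:
      "\<lbrakk>openin X U; openin X V; V \<subseteq> U; a \<in> carrier (A U); x \<in> carrier (E U)\<rbrakk>
        \<Longrightarrow> \<sigma> U V (a \<odot>\<^bsub>E U\<^esub> x) = \<rho> U V a \<odot>\<^bsub>E V\<^esub> \<sigma> U V x"

definition sheaf_morphism ::
  "'x topology \<Rightarrow> ('x set \<Rightarrow> (complex, 'a) module)
    \<Rightarrow> ('x set \<Rightarrow> ('a, 'e) module) \<Rightarrow> ('x set \<Rightarrow> 'x set \<Rightarrow> 'e \<Rightarrow> 'e)
    \<Rightarrow> ('x set \<Rightarrow> ('a, 'f) module) \<Rightarrow> ('x set \<Rightarrow> 'x set \<Rightarrow> 'f \<Rightarrow> 'f)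
    \<Rightarrow> ('x set \<Rightarrow> 'e \<Rightarrow> 'f) \<Rightarrow> bool"
  where "sheaf_morphism X A E \<sigma> F \<tau> \<phi> \<longleftrightarrow>
    (\<forall>U. openin X U \<longrightarrow> \<phi> U \<in> mod_hom (A U) (E U) (F U)) \<and>
    (\<forall>U V. openin X U \<longrightarrow> openin X V \<longrightarrow> V \<subseteq> U \<longrightarrow>
       (\<forall>x\<in>carrier (E U). \<phi> V (\<sigma> U V x) = \<tau> U V (\<phi> U x)))"

definition sheaf_isomorphism ::
  "'x topology \<Rightarrow> ('x set \<Rightarrow> (complex, 'a) module)
    \<Rightarrow> ('x set \<Rightarrow> ('a, 'e) module) \<Rightarrow> ('x set \<Rightarrow> 'x set \<Rightarrow> 'e \<Rightarrow> 'e)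
    \<Rightarrow> ('x set \<Rightarrow> ('a, 'f) module) \<Rightarrow> ('x set \<Rightarrow> 'x set \<Rightarrow> 'f \<Rightarrow> 'f)
    \<Rightarrow> ('x set \<Rightarrow> 'e \<Rightarrow> 'f) \<Rightarrow> bool"
  where "sheaf_isomorphism X A E \<sigma> F \<tau> \<psi> \<longleftrightarrow>
    sheaf_morphism X A E \<sigma> F \<tau> \<psi> \<and>
    (\<forall>U. openin X U \<longrightarrow> bij_betw (\<psi> U) (carrier (E U)) (carrier (F U)))"

text \<open>The sheaf \<open>A\<^sup>n\<close>, with sections \<open>free_module (A U) n\<close>, is restricted componentwise.\<close>

definition free_res :: "('x set \<Rightarrow> 'x set \<Rightarrow> 'a \<Rightarrow> 'a) \<Rightarrow> nat
    \<Rightarrow> 'x set \<Rightarrow> 'x set \<Rightarrow> (nat \<Rightarrow> 'a) \<Rightarrow> (nat \<Rightarrow> 'a)"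
  where "free_res \<rho> n U V v = (\<lambda>i\<in>{..<n}. \<rho> U V (v i))"

text \<open>For open \<open>U\<close>, the open sets of \<open>subtopology X U\<close> are the open sets of \<open>X\<close> inside \<open>U\<close>;
  hence the restriction of a sheaf to \<open>U\<close> has the same data, over \<open>subtopology X U\<close>.\<close>

definition trivialization ::
  "'x topology \<Rightarrow> ('x set \<Rightarrow> (complex, 'a) module) \<Rightarrow> ('x set \<Rightarrow> 'x set \<Rightarrow> 'a \<Rightarrow> 'a)
    \<Rightarrow> ('x set \<Rightarrow> ('a, 'e) module) \<Rightarrow> ('x set \<Rightarrow> 'x set \<Rightarrow> 'e \<Rightarrow> 'e)
    \<Rightarrow> nat \<Rightarrow> 'x set \<Rightarrow> ('x set \<Rightarrow> 'e \<Rightarrow> nat \<Rightarrow> 'a) \<Rightarrow> bool"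
  where "trivialization X A \<rho> E \<sigma> n U \<psi> \<longleftrightarrow>
    sheaf_isomorphism (subtopology X U) A E \<sigma> (\<lambda>V. free_module (A V) n) (free_res \<rho> n) \<psi>"

definition local_gauge ::
  "'x topology \<Rightarrow> ('x set \<Rightarrow> (complex, 'a) module) \<Rightarrow> ('x set \<Rightarrow> 'x set \<Rightarrow> 'a \<Rightarrow> 'a)
    \<Rightarrow> ('x set \<Rightarrow> ('a, 'e) module) \<Rightarrow> ('x set \<Rightarrow> 'x set \<Rightarrow> 'e \<Rightarrow> 'e)
    \<Rightarrow> nat \<Rightarrow> 'x set \<Rightarrow> bool"
  where "local_gauge X A \<rho> E \<sigma> n U \<longleftrightarrow>
    openin X U \<and> (\<exists>\<psi>. trivialization X A \<rho> E \<sigma> n U \<psi>)"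

locale vector_sheaf =
  sheaf_of_modules X A \<rho> E \<sigma>
  for X :: "'x topology" and A :: "'x set \<Rightarrow> (complex, 'a) module"
    and \<rho> :: "'x set \<Rightarrow> 'x set \<Rightarrow> 'a \<Rightarrow> 'a"
    and E :: "'x set \<Rightarrow> ('a, 'e) module"
    and \<sigma> :: "'x set \<Rightarrow> 'x set \<Rightarrow> 'e \<Rightarrow> 'e"
    and n :: nat +
  assumes locally_free:
    "x \<in> topspace X \<Longrightarrow> \<exists>U. x \<in> U \<and> local_gauge X A \<rho> E \<sigma> n U"

definition gauge_basis ::
  "('x set \<Rightarrow> (complex, 'a) module) \<Rightarrow> ('x set \<Rightarrow> ('a, 'e) module)
    \<Rightarrow> nat \<Rightarrow> 'x set \<Rightarrow> ('x set \<Rightarrow> 'e \<Rightarrow> nat \<Rightarrow> 'a) \<Rightarrow> nat \<Rightarrow> 'e"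
  where "gauge_basis A E n U \<psi> i = inv_into (carrier (E U)) (\<psi> U) (kronecker (A U) n i)"

lemma (in sheaf_of_modules) is_basis_gauge_basis:
  assumes U: "openin X U" and \<psi>: "trivialization X A \<rho> E \<sigma> n U \<psi>"
  shows "is_basis (A U) (E U) n (gauge_basis A E n U \<psi>)"
proof -
  interpret Module.module "A U" "E U" by (rule module_sections) fact
  interpret F: Module.module "A U" "free_module (A U) n" by (rule module_free_module) unfold_locales
  let ?F = "free_module (A U) n" and ?b = "gauge_basis A E n U \<psi>"
  have "openin (subtopology X U) U" using U by (simp add: openin_open_subtopology)
  then have hom: "\<psi> U \<in> mod_hom (A U) (E U) ?F" and bij: "bij_betw (\<psi> U) (carrier (E U)) (carrier ?F)"
    using \<psi> by (auto simp: trivialization_def sheaf_isomorphism_def sheaf_morphism_def)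
  note h = mod_homD[OF hom]
  have k: "kronecker (A U) n i \<in> carrier ?F" for i
    by (auto simp: free_module_def kronecker_def)
  have b: "?b i \<in> carrier (E U)" and \<psi>b: "\<psi> U (?b i) = kronecker (A U) n i" for i
    using k[of i] bij inv_into_into[of _ "\<psi> U" "carrier (E U)"] f_inv_into_f[of _ "\<psi> U" "carrier (E U)"]
    by (simp_all add: gauge_basis_def bij_betw_def)
  have sum: "\<psi> U (\<Oplus>\<^bsub>E U\<^esub>i\<in>S. g i) = (\<Oplus>\<^bsub>?F\<^esub>i\<in>S. \<psi> U (g i))"
    if "finite S" "g \<in> S \<rightarrow> carrier (E U)" for g :: "nat \<Rightarrow> 'e" and S
    using that
  proof (induction S)
    case empty
    have "\<psi> U \<zero>\<^bsub>E U\<^esub> \<oplus>\<^bsub>?F\<^esub> \<psi> U \<zero>\<^bsub>E U\<^esub> = \<psi> U \<zero>\<^bsub>E U\<^esub>"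
      using h(2)[of "\<zero>\<^bsub>E U\<^esub>" "\<zero>\<^bsub>E U\<^esub>"] by simp
    then have "\<psi> U \<zero>\<^bsub>E U\<^esub> = \<zero>\<^bsub>?F\<^esub>"
      using h(1)[of "\<zero>\<^bsub>E U\<^esub>"] F.add.l_cancel_one' by (metis M.zero_closed)
    then show ?case by simp
  next
    case (insert x S)
    then have "(\<lambda>i. \<psi> U (g i)) \<in> S \<rightarrow> carrier ?F" "\<psi> U (g x) \<in> carrier ?F" using h(1) by auto
    with insert show ?case by (simp add: h(2))
  qed
  have rep: "x = (\<Oplus>\<^bsub>E U\<^esub>i\<in>{..<n}. c i \<odot>\<^bsub>E U\<^esub> ?b i) \<longleftrightarrow> \<psi> U x = c"
    if x: "x \<in> carrier (E U)" and c: "c \<in> {..<n} \<rightarrow>\<^sub>E carrier (A U)" for x c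
  proof -
    have g: "(\<lambda>i. c i \<odot>\<^bsub>E U\<^esub> ?b i) \<in> {..<n} \<rightarrow> carrier (E U)"
      using b c by (auto simp: PiE_iff)
    have "\<psi> U (\<Oplus>\<^bsub>E U\<^esub>i\<in>{..<n}. c i \<odot>\<^bsub>E U\<^esub> ?b i) =
        (\<Oplus>\<^bsub>?F\<^esub>i\<in>{..<n}. \<psi> U (c i \<odot>\<^bsub>E U\<^esub> ?b i))"
      by (rule sum[OF _ g]) simp
    also have "\<dots> = (\<Oplus>\<^bsub>?F\<^esub>i\<in>{..<n}. c i \<odot>\<^bsub>?F\<^esub> kronecker (A U) n i)"
      using c b k by (intro F.finsum_cong') (auto simp: h(3) \<psi>b PiE_iff)
    also have "\<dots> = c"
      by (rule finsum_kronecker[OF _ c]) unfold_locales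
    finally have sum_c: "\<psi> U (\<Oplus>\<^bsub>E U\<^esub>i\<in>{..<n}. c i \<odot>\<^bsub>E U\<^esub> ?b i) = c" .
    have "x = (\<Oplus>\<^bsub>E U\<^esub>i\<in>{..<n}. c i \<odot>\<^bsub>E U\<^esub> ?b i) \<longleftrightarrow>
        \<psi> U x = \<psi> U (\<Oplus>\<^bsub>E U\<^esub>i\<in>{..<n}. c i \<odot>\<^bsub>E U\<^esub> ?b i)"
      by (rule inj_on_eq_iff[OF bij_betw_imp_inj_on[OF bij] x M.finsum_closed[OF g], symmetric])
    then show ?thesis
      unfolding sum_c .
  qed
  have "\<exists>!c. c \<in> {..<n} \<rightarrow>\<^sub>E carrier (A U) \<and> x = (\<Oplus>\<^bsub>E U\<^esub>i\<in>{..<n}. c i \<odot>\<^bsub>E U\<^esub> ?b i)"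
    if x: "x \<in> carrier (E U)" for x
  proof (rule ex1I[of _ "\<psi> U x"])
    have c: "\<psi> U x \<in> {..<n} \<rightarrow>\<^sub>E carrier (A U)"
      using h(1)[OF x] by (simp add: free_module_def)
    show "\<psi> U x \<in> {..<n} \<rightarrow>\<^sub>E carrier (A U) \<and> x = (\<Oplus>\<^bsub>E U\<^esub>i\<in>{..<n}. \<psi> U x i \<odot>\<^bsub>E U\<^esub> ?b i)"
      by (rule conjI[OF c iffD2[OF rep[OF x c] refl]])
  next
    fix c assume c: "c \<in> {..<n} \<rightarrow>\<^sub>E carrier (A U) \<and> x = (\<Oplus>\<^bsub>E U\<^esub>i\<in>{..<n}. c i \<odot>\<^bsub>E U\<^esub> ?b i)"
    show "c = \<psi> U x"
      by (rule sym, rule iffD1[OF rep[OF x conjunct1[OF c]] conjunct2[OF c]])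
  qed
  then show ?thesis
    unfolding is_basis_def by (intro conjI Pi_I ballI b)
qed

definition charpoly_gauge ::
  "('x set \<Rightarrow> (complex, 'a) module) \<Rightarrow> ('x set \<Rightarrow> ('a, 'e) module)
    \<Rightarrow> nat \<Rightarrow> ('x set \<Rightarrow> 'e \<Rightarrow> 'e) \<Rightarrow> 'x set \<Rightarrow> ('x set \<Rightarrow> 'e \<Rightarrow> nat \<Rightarrow> 'a) \<Rightarrow> nat \<Rightarrow> 'a"
  where "charpoly_gauge A E n \<phi> U \<psi> =
    charpoly (A U) n (rep_matrix (A U) (E U) n (gauge_basis A E n U \<psi>) (\<phi> U))"

end

theory Submission
  imports Defs "HOL-Algebra.Subrings"
begin

text \<open>Let the polynomial ring act on the module \<open>M\<close> with basis \<open>b\<close> through evaluation at the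
  endomorphism \<open>f\<close>. The columns of \<open>t I - A\<close>, where \<open>A\<close> is the matrix of \<open>f\<close>, are linear
  relations between the basis vectors over this ring, so the determinant of \<open>t I - A\<close> annihilates
  every basis vector and hence \<open>M\<close>.\<close>

section \<open>Finite sums and determinants over a commutative ring\<close>

lemma (in abelian_monoid) finsum_swap:
  assumes "finite A" "finite B" "\<And>a b. \<lbrakk>a \<in> A; b \<in> B\<rbrakk> \<Longrightarrow> f a b \<in> carrier G"
  shows "(\<Oplus>a\<in>A. \<Oplus>b\<in>B. f a b) = (\<Oplus>b\<in>B. \<Oplus>a\<in>A. f a b)"
  using assms(1,3)
proof (induction A)
  case empty
  then show ?case by (simp add: finsum_zero)
next
  case (insert x A)
  then have "(\<Oplus>a\<in>insert x A. \<Oplus>b\<in>B. f a b) = (\<Oplus>b\<in>B. f x b) \<oplus> (\<Oplus>b\<in>B. \<Oplus>a\<in>A. f a b)"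
    by (subst finsum_insert) (auto intro!: finsum_closed)
  also have "\<dots> = (\<Oplus>b\<in>B. f x b \<oplus> (\<Oplus>a\<in>A. f a b))"
    using insert.prems by (intro finsum_addf[symmetric]) (auto intro!: finsum_closed)
  also have "\<dots> = (\<Oplus>b\<in>B. \<Oplus>a\<in>insert x A. f a b)"
    using insert.hyps insert.prems
    by (intro finsum_cong') (auto intro!: finsum_closed simp: Pi_iff finsum_insert)
  finally show ?case .
qed

lemma (in module) finsum_smult_rdistr:
  assumes "finite A" "x \<in> carrier M" "f \<in> A \<rightarrow> carrier R"
  shows "(\<Oplus>\<^bsub>R\<^esub>i\<in>A. f i) \<odot>\<^bsub>M\<^esub> x = (\<Oplus>\<^bsub>M\<^esub>i\<in>A. f i \<odot>\<^bsub>M\<^esub> x)"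
  using assms by (induction A) (auto simp: Pi_iff smult_l_distr)

lemma (in cring) ring_det_closed:
  assumes "\<And>i j. \<lbrakk>i < n; j < n\<rbrakk> \<Longrightarrow> A i j \<in> carrier R"
  shows "ring_det R n A \<in> carrier R"
proof -
  have "p i < n" if "p permutes {..<n}" "i < n" for p i
    using permutes_in_image[OF that(1), of i] that(2) by simp
  then show ?thesis
    unfolding ring_det_def using assms by (auto intro!: finsum_closed add.int_pow_closed)
qed

text \<open>Composing with the transposition of \<open>k\<close> and \<open>l\<close> pairs the even
  permutations with the odd ones. Paired terms have the same product and opposite signs, so they
  cancel. This gives zero directly, whereas antisymmetry of the determinant would only make its
  double vanish.\<close>

lemma (in cring) ring_det_equal_rows:
  assumes A: "\<And>i j. \<lbrakk>i < n; j < n\<rbrakk> \<Longrightarrow> A i j \<in> carrier R"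
    and k: "k < n" and l: "l < n" and "k \<noteq> l"
    and eq: "\<And>j. j < n \<Longrightarrow> A k j = A l j"
  shows "ring_det R n A = \<zero>"
proof -
  let ?P = "{p. p permutes {..<n}}"
  let ?t = "Transposition.transpose k l"
  let ?E = "{p \<in> ?P. evenperm p}" and ?O = "{p \<in> ?P. \<not> evenperm p}"
  let ?d = "\<lambda>p. \<Otimes>i\<in>{..<n}. A i (p i)"
  let ?f = "\<lambda>p. [(sign p :: int)] \<cdot> ?d p"
  have t: "?t permutes {..<n}"
    using k l by (intro permutes_swap_id) auto
  have p_less: "p i < n" if "p permutes {..<n}" "i < n" for p i
    using permutes_in_image[OF that(1), of i] that(2) by simp
  have d: "?d p \<in> carrier R" if "p \<in> ?P" for p
    using that A p_less[of p] by auto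
  have f: "?f p \<in> carrier R" if "p \<in> ?P" for p
    using d[OF that] by (rule add.int_pow_closed)
  have fin: "finite ?P" by (rule finite_permutations) simp
  have perm: "permutation p" if "p \<in> ?P" for p
    using that permutation_permutes[of p] by blast
  have tt: "permutation ?t" by (rule permutation_swap_id)
  have even_t: "evenperm (p \<circ> ?t) \<longleftrightarrow> \<not> evenperm p" if "p \<in> ?P" for p
    using evenperm_comp[OF perm[OF that] tt] \<open>k \<noteq> l\<close> by (simp add: evenperm_swap)
  have comp_P: "p \<circ> ?t \<in> ?P" if "p \<in> ?P" for p
    using that t by (simp add: permutes_compose)
  \<comment> \<open>Since \<open>?t\<close> is its own inverse, every odd \<open>p\<close> is the
    image of the even permutation \<open>p \<circ> ?t\<close>.\<close>
  have O: "?O = (\<lambda>p. p \<circ> ?t) ` ?E"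
  proof (intro equalityI subsetI)
    fix p assume p: "p \<in> ?O"
    then have "p \<circ> ?t \<in> ?E" using comp_P[of p] even_t[of p] by simp
    moreover have "p = (p \<circ> ?t) \<circ> ?t" by (simp add: comp_assoc)
    ultimately show "p \<in> (\<lambda>p. p \<circ> ?t) ` ?E" by blast
  next
    fix p assume "p \<in> (\<lambda>p. p \<circ> ?t) ` ?E"
    then show "p \<in> ?O" using comp_P even_t by auto
  qed
  have inj: "inj_on (\<lambda>p. p \<circ> ?t) ?E"
    by (rule inj_on_inverseI[where g = "\<lambda>p. p \<circ> ?t"]) (simp add: comp_assoc)
  \<comment> \<open>Reindexing the product by \<open>?t\<close> moves the transposition from the
    column index to the row index, where it is absorbed because rows \<open>k\<close> and
    \<open>l\<close> agree.\<close>
  have d_t: "?d (p \<circ> ?t) = ?d p" if p: "p \<in> ?P" for p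
  proof -
    have ti: "?t i < n" and pi: "p i < n" if "i < n" for i
      using p_less[OF t that] p_less[OF _ that, of p] p by simp_all
    have "?d (p \<circ> ?t) = (\<Otimes>i\<in>?t ` {..<n}. A i (p (?t i)))"
      by (simp add: permutes_image[OF t])
    also have "\<dots> = (\<Otimes>i\<in>{..<n}. A (?t i) (p (?t (?t i))))"
      using A pi ti by (intro finprod_reindex permutes_inj_on[OF t]) auto
    also have "\<dots> = ?d p"
    proof (rule finprod_cong'[OF refl])
      fix i assume "i \<in> {..<n}"
      then show "A (?t i) (p (?t (?t i))) = A i (p i)"
        using pi[of i] eq[of "p i"] by (auto simp: Transposition.transpose_def)
    qed (use A pi in auto)
    finally show ?thesis .
  qed
  have f_t: "?f (p \<circ> ?t) = \<ominus> ?f p" if p: "p \<in> ?E" for p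
  proof -
    have "p \<in> ?P" "evenperm p" using p by auto
    then show ?thesis
      using even_t[of p] d_t[of p] d[of p]
      by (simp add: sign_def add.int_pow_neg add.int_pow_1 del: comp_apply)
  qed
  have "ring_det R n A = (\<Oplus>p\<in>?E \<union> ?O. ?f p)"
    unfolding ring_det_def by (rule arg_cong[of _ _ "finsum R ?f"]) auto
  also have "\<dots> = (\<Oplus>p\<in>?E. ?f p) \<oplus> (\<Oplus>p\<in>?O. ?f p)"
    using fin f by (intro finsum_Un_disjoint) auto
  also have "(\<Oplus>p\<in>?O. ?f p) = (\<Oplus>p\<in>?E. ?f (p \<circ> ?t))"
    unfolding O using f comp_P inj by (intro finsum_reindex) auto
  also have "(\<Oplus>p\<in>?E. ?f (p \<circ> ?t)) = (\<Oplus>p\<in>?E. \<ominus> ?f p)"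
    using f_t f by (intro finsum_cong') auto
  also have "(\<Oplus>p\<in>?E. ?f p) \<oplus> (\<Oplus>p\<in>?E. \<ominus> ?f p) = (\<Oplus>p\<in>?E. ?f p \<oplus> \<ominus> ?f p)"
    using f by (intro finsum_addf[symmetric]) auto
  also have "\<dots> = (\<Oplus>p\<in>?E. \<zero>)"
    using f by (intro finsum_cong') (auto simp: r_neg)
  finally show ?thesis by simp
qed

text \<open>The determinant trick without adjugates: replacing row \<open>k\<close> by row \<open>l\<close> annihilates the
  determinant unless \<open>l = k\<close>, so \<open>det T \<odot> e k\<close> is the sum over \<open>l\<close> of these determinants times
  \<open>e l\<close>. Collecting the terms of each permutation \<open>p\<close> leaves the relation of column \<open>p k\<close>.\<close>

lemma (in module) ring_det_smult_eq_zero: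
  assumes T: "\<And>i j. \<lbrakk>i < n; j < n\<rbrakk> \<Longrightarrow> T i j \<in> carrier R"
    and e: "\<And>i. i < n \<Longrightarrow> e i \<in> carrier M"
    and rel: "\<And>j. j < n \<Longrightarrow> (\<Oplus>\<^bsub>M\<^esub>i\<in>{..<n}. T i j \<odot>\<^bsub>M\<^esub> e i) = \<zero>\<^bsub>M\<^esub>"
    and k: "k < n"
  shows "ring_det R n T \<odot>\<^bsub>M\<^esub> e k = \<zero>\<^bsub>M\<^esub>"
proof -
  let ?P = "{p. p permutes {..<n}}"
  \<comment> \<open>Row \<open>k\<close> of \<open>T\<close> is overwritten by row \<open>l\<close>;
    in particular \<open>?T k\<close> is \<open>T\<close> itself.\<close>
  let ?T = "\<lambda>l. T(k := T l)"
  \<comment> \<open>The signed product of \<open>p\<close> without its factor from row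
    \<open>k\<close>. The matrices \<open>?T l\<close> differ only in that row, so
    \<open>c p\<close> is independent of \<open>l\<close>, and \<open>det\<close> below expands all
    their determinants with the same coefficients.\<close>
  define c where "c p = [(sign p :: int)] \<cdot>\<^bsub>R\<^esub> (\<Otimes>\<^bsub>R\<^esub>i\<in>{..<n} - {k}. T i (p i))" for p
  have fin: "finite ?P" by (rule finite_permutations) simp
  have p_less: "p i < n" if "p \<in> ?P" "i < n" for p i
    using permutes_in_image[of p "{..<n}" i] that by simp
  have prod: "(\<Otimes>\<^bsub>R\<^esub>i\<in>{..<n} - {k}. T i (p i)) \<in> carrier R" if "p \<in> ?P" for p
    using T p_less[OF that] by (intro R.finprod_closed) auto
  have c: "c p \<in> carrier R" if "p \<in> ?P" for p
    unfolding c_def using prod[OF that] by (rule R.add.int_pow_closed)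
  have Tl: "?T l i j \<in> carrier R" if "l < n" "i < n" "j < n" for l i j
    using T that by auto
  have det_Tl: "ring_det R n (?T l) \<in> carrier R" if "l < n" for l
    by (rule R.ring_det_closed) (rule Tl[OF that])
  have det: "ring_det R n (?T l) = (\<Oplus>\<^bsub>R\<^esub>p\<in>?P. c p \<otimes>\<^bsub>R\<^esub> T l (p k))" if l: "l < n" for l
    unfolding ring_det_def
  proof (rule R.finsum_cong'[OF refl])
    show "(\<lambda>p. c p \<otimes>\<^bsub>R\<^esub> T l (p k)) \<in> ?P \<rightarrow> carrier R"
      using c T l k p_less by auto
    fix p assume p: "p \<in> ?P"
    have "(\<Otimes>\<^bsub>R\<^esub>i\<in>{..<n}. ?T l i (p i)) = (\<Otimes>\<^bsub>R\<^esub>i\<in>insert k ({..<n} - {k}). ?T l i (p i))"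
      using k by (simp add: insert_absorb)
    also have "\<dots> = T l (p k) \<otimes>\<^bsub>R\<^esub> (\<Otimes>\<^bsub>R\<^esub>i\<in>{..<n} - {k}. ?T l i (p i))"
      using T l k p_less[OF p] by (subst R.finprod_insert) auto
    also have "(\<Otimes>\<^bsub>R\<^esub>i\<in>{..<n} - {k}. ?T l i (p i)) = (\<Otimes>\<^bsub>R\<^esub>i\<in>{..<n} - {k}. T i (p i))"
      using T p_less[OF p] by (intro R.finprod_cong') auto
    finally show "[(sign p :: int)] \<cdot>\<^bsub>R\<^esub> (\<Otimes>\<^bsub>R\<^esub>i\<in>{..<n}. ?T l i (p i)) = c p \<otimes>\<^bsub>R\<^esub> T l (p k)"
      using prod[OF p] T[OF l p_less[OF p k]]
      by (simp add: c_def R.add_pow_rdistr_int R.m_comm)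
  qed
  have closed: "T l (p k) \<odot>\<^bsub>M\<^esub> e l \<in> carrier M" if "l < n" "p \<in> ?P" for l p
    using T e k p_less that by auto
  have "ring_det R n T \<odot>\<^bsub>M\<^esub> e k = (\<Oplus>\<^bsub>M\<^esub>l\<in>{..<n}. if k = l then ring_det R n T \<odot>\<^bsub>M\<^esub> e l else \<zero>\<^bsub>M\<^esub>)"
    using k e R.ring_det_closed[OF T] by (intro M.finsum_singleton[symmetric]) auto
  also have "\<dots> = (\<Oplus>\<^bsub>M\<^esub>l\<in>{..<n}. ring_det R n (?T l) \<odot>\<^bsub>M\<^esub> e l)"
  proof (rule M.finsum_cong'[OF refl])
    show "(\<lambda>l. ring_det R n (?T l) \<odot>\<^bsub>M\<^esub> e l) \<in> {..<n} \<rightarrow> carrier M"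
      using e det_Tl by auto
    fix l assume "l \<in> {..<n}"
    then have l: "l < n" by simp
    \<comment> \<open>Rows \<open>k\<close> and \<open>l\<close> of \<open>?T l\<close> are both row
      \<open>l\<close> of \<open>T\<close>.\<close>
    have "ring_det R n (?T l) = \<zero>\<^bsub>R\<^esub>" if "k \<noteq> l"
      by (rule R.ring_det_equal_rows[OF Tl[OF l] k l that]) (use that in auto)
    then show "(if k = l then ring_det R n T \<odot>\<^bsub>M\<^esub> e l else \<zero>\<^bsub>M\<^esub>) = ring_det R n (?T l) \<odot>\<^bsub>M\<^esub> e l"
      using e[OF l] by auto
  qed
  also have "\<dots> = (\<Oplus>\<^bsub>M\<^esub>l\<in>{..<n}. \<Oplus>\<^bsub>M\<^esub>p\<in>?P. c p \<odot>\<^bsub>M\<^esub> (T l (p k) \<odot>\<^bsub>M\<^esub> e l))"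
  proof (rule M.finsum_cong'[OF refl])
    show "(\<lambda>l. \<Oplus>\<^bsub>M\<^esub>p\<in>?P. c p \<odot>\<^bsub>M\<^esub> (T l (p k) \<odot>\<^bsub>M\<^esub> e l)) \<in> {..<n} \<rightarrow> carrier M"
      using closed c by (auto intro!: M.finsum_closed)
    fix l assume "l \<in> {..<n}"
    then have l: "l < n" by simp
    have "ring_det R n (?T l) \<odot>\<^bsub>M\<^esub> e l = (\<Oplus>\<^bsub>M\<^esub>p\<in>?P. (c p \<otimes>\<^bsub>R\<^esub> T l (p k)) \<odot>\<^bsub>M\<^esub> e l)"
      unfolding det[OF l] using fin c T l k p_less e by (intro finsum_smult_rdistr) auto
    also have "\<dots> = (\<Oplus>\<^bsub>M\<^esub>p\<in>?P. c p \<odot>\<^bsub>M\<^esub> (T l (p k) \<odot>\<^bsub>M\<^esub> e l))"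
      using c T l k p_less e closed by (intro M.finsum_cong') (auto simp: smult_assoc1)
    finally show "ring_det R n (?T l) \<odot>\<^bsub>M\<^esub> e l = (\<Oplus>\<^bsub>M\<^esub>p\<in>?P. c p \<odot>\<^bsub>M\<^esub> (T l (p k) \<odot>\<^bsub>M\<^esub> e l))" .
  qed
  also have "\<dots> = (\<Oplus>\<^bsub>M\<^esub>p\<in>?P. \<Oplus>\<^bsub>M\<^esub>l\<in>{..<n}. c p \<odot>\<^bsub>M\<^esub> (T l (p k) \<odot>\<^bsub>M\<^esub> e l))"
    using fin closed c by (intro M.finsum_swap) auto
  also have "\<dots> = (\<Oplus>\<^bsub>M\<^esub>p\<in>?P. \<zero>\<^bsub>M\<^esub>)"
  proof (rule M.finsum_cong'[OF refl])
    fix p assume p: "p \<in> ?P"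
    have "(\<Oplus>\<^bsub>M\<^esub>l\<in>{..<n}. c p \<odot>\<^bsub>M\<^esub> (T l (p k) \<odot>\<^bsub>M\<^esub> e l)) =
        c p \<odot>\<^bsub>M\<^esub> (\<Oplus>\<^bsub>M\<^esub>l\<in>{..<n}. T l (p k) \<odot>\<^bsub>M\<^esub> e l)"
      using closed[OF _ p] c[OF p] by (intro finsum_smult_ldistr[symmetric]) auto
    then show "(\<Oplus>\<^bsub>M\<^esub>l\<in>{..<n}. c p \<odot>\<^bsub>M\<^esub> (T l (p k) \<odot>\<^bsub>M\<^esub> e l)) = \<zero>\<^bsub>M\<^esub>"
      using rel[OF p_less[OF p k]] c[OF p] by simp
  qed simp
  finally show ?thesis by simp
qed

section \<open>Polynomial evaluation in a noncommutative ring\<close>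

text \<open>This lets an evaluation, which is a finite sum, be computed in a subring containing all
  its summands. Over an infinite index set both sides take the default value zero.\<close>

lemma (in ring) finsum_subring:
  assumes "subring H R" "f \<in> A \<rightarrow> H"
  shows "finsum (R\<lparr>carrier := H\<rparr>) f A = finsum R f A"
proof -
  interpret H: ring "R\<lparr>carrier := H\<rparr>" by (rule subring_is_ring) fact
  have "H \<subseteq> carrier R" by (rule subringE(1)) fact
  with assms(2) show ?thesis
    by (induction A rule: infinite_finite_induct) (auto simp: Pi_iff subset_iff)
qed

lemma (in ring) subring_commutant:
  assumes "B \<subseteq> carrier R"
  shows "subring {x \<in> carrier R. \<forall>y\<in>B. x \<otimes> y = y \<otimes> x} R"
proof (rule subringI)
  fix x y
  assume x: "x \<in> {x \<in> carrier R. \<forall>y\<in>B. x \<otimes> y = y \<otimes> x}"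
    and y: "y \<in> {x \<in> carrier R. \<forall>y\<in>B. x \<otimes> y = y \<otimes> x}"
  have "(x \<otimes> y) \<otimes> z = z \<otimes> (x \<otimes> y)" if "z \<in> B" for z
  proof -
    have "z \<in> carrier R" using that assms by blast
    then show ?thesis using x y that by (simp add: m_assoc) (simp add: m_assoc[symmetric])
  qed
  then show "x \<otimes> y \<in> {x \<in> carrier R. \<forall>y\<in>B. x \<otimes> y = y \<otimes> x}" using x y by simp
qed (use assms in \<open>auto simp: l_minus r_minus l_distr r_distr subset_iff\<close>)

text \<open>The library's \<^term>\<open>UP_pre_univ_prop\<close> asks for a commutative target. The values of the
  evaluation lie in the double commutant of \<open>s\<close>, which is commutative.\<close>

lemma eval_central_hom:
  assumes "cring R" "ring S" and h: "h \<in> ring_hom R S" and s: "s \<in> carrier S"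
    and central: "\<forall>r\<in>carrier R. \<forall>x\<in>carrier S. h r \<otimes>\<^bsub>S\<^esub> x = x \<otimes>\<^bsub>S\<^esub> h r"
  shows "eval R S h s \<in> ring_hom (UP R) S"
    and "eval R S h s (up_ring.monom (UP R) \<one>\<^bsub>R\<^esub> 1) = s"
    and "r \<in> carrier R \<Longrightarrow> eval R S h s (up_ring.monom (UP R) r 0) = h r"
proof -
  interpret R: cring R by fact
  interpret S: ring S by fact
  interpret P: UP_cring R "UP R" by unfold_locales simp
  \<comment> \<open>\<open>C\<close> is the commutant of \<open>s\<close> and \<open>D\<close> is
    the commutant of \<open>C\<close>.\<close>
  define C where "C = {x \<in> carrier S. x \<otimes>\<^bsub>S\<^esub> s = s \<otimes>\<^bsub>S\<^esub> x}"
  define D where "D = {x \<in> carrier S. \<forall>y\<in>C. x \<otimes>\<^bsub>S\<^esub> y = y \<otimes>\<^bsub>S\<^esub> x}"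
  let ?D = "S\<lparr>carrier := D\<rparr>"
  have sub: "subring D S"
    unfolding D_def by (rule S.subring_commutant) (auto simp: C_def)
  have D_S: "D \<subseteq> carrier S" by (auto simp: D_def)
  have sC: "s \<in> C" using s by (simp add: C_def)
  have sD: "s \<in> D" using s by (auto simp: C_def D_def)
  \<comment> \<open>As \<open>s\<close> lies in \<open>C\<close>, everything in \<open>D\<close>
    commutes with \<open>s\<close>. Elements of \<open>D\<close> commute with all of
    \<open>C\<close>, hence now with each other.\<close>
  have "D \<subseteq> C" using sC by (auto simp: C_def D_def)
  then have "subcring D S"
    by (intro S.subcringI[OF sub]) (auto simp: D_def)
  then have "cring ?D" using S.subcring_iff[OF D_S] by blast
  then interpret D: cring ?D .
  note hE = ring_hom_memE[OF h]
  \<comment> \<open>Being central, \<open>h r\<close> commutes with all of \<open>C\<close>. So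
    \<open>h\<close> takes its values in \<open>D\<close>, and the universal property of polynomial
    rings applies to the commutative target \<open>?D\<close>.\<close>
  have hD: "h r \<in> D" if "r \<in> carrier R" for r
    using hE(1)[OF that] central that s by (auto simp: D_def C_def)
  have "h \<in> ring_hom R ?D"
    by (rule ring_hom_memI) (use hE hD in auto)
  then interpret U: UP_pre_univ_prop R ?D h "UP R" by unfold_locales simp_all
  have pow: "s [^]\<^bsub>?D\<^esub> i = s [^]\<^bsub>S\<^esub> i" for i :: nat
    by (simp add: nat_pow_def)
  have summand: "h (coeff (UP R) p i) \<otimes>\<^bsub>S\<^esub> s [^]\<^bsub>S\<^esub> i \<in> D" if "p \<in> carrier (UP R)" for p i
    using D.m_closed[of "h (coeff (UP R) p i)" "s [^]\<^bsub>?D\<^esub> i"] D.nat_pow_closed[of s i] sD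
      hD[OF P.coeff_closed[OF that]] by (simp add: pow)
  \<comment> \<open>All summands lie in \<open>D\<close>, so evaluation in \<open>S\<close> and in
    \<open>?D\<close> agree, and the homomorphism property transfers back to
    \<open>S\<close>.\<close>
  have ev: "eval R S h s p = eval R ?D h s p" if "p \<in> carrier (UP R)" for p
    using S.finsum_subring[OF sub, of "\<lambda>i. h (coeff (UP R) p i) \<otimes>\<^bsub>S\<^esub> s [^]\<^bsub>S\<^esub> i"] summand[OF that] that
    by (simp add: UnivPoly.eval_def pow)
  have hom: "eval R ?D h s \<in> ring_hom (UP R) ?D"
    by (rule U.eval_ring_hom) (simp add: sD)
  note evE = ring_hom_memE[OF hom]
  show "eval R S h s \<in> ring_hom (UP R) S"
    by (rule ring_hom_memI) (use evE D_S in \<open>auto simp: ev\<close>)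
  show "eval R S h s (up_ring.monom (UP R) \<one>\<^bsub>R\<^esub> 1) = s"
    using U.eval_monom1[of s] sD by (simp add: ev)
  show "eval R S h s (up_ring.monom (UP R) r 0) = h r" if "r \<in> carrier R"
    using U.eval_const[of s r] sD that by (simp add: ev)
qed

section \<open>The Cayley-Hamilton theorem for a module with a basis\<close>

lemma coords_basis:
  assumes "is_basis R M n b" "x \<in> carrier M"
  shows "i < n \<Longrightarrow> coords R M n b x i \<in> carrier R"
    and "(\<Oplus>\<^bsub>M\<^esub>i\<in>{..<n}. coords R M n b x i \<odot>\<^bsub>M\<^esub> b i) = x"
proof -
  have "\<exists>!c. c \<in> {..<n} \<rightarrow>\<^sub>E carrier R \<and> x = (\<Oplus>\<^bsub>M\<^esub>i\<in>{..<n}. c i \<odot>\<^bsub>M\<^esub> b i)"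
    using assms unfolding is_basis_def by blast
  from theI'[OF this]
  have *: "coords R M n b x \<in> {..<n} \<rightarrow>\<^sub>E carrier R"
    "x = (\<Oplus>\<^bsub>M\<^esub>i\<in>{..<n}. coords R M n b x i \<odot>\<^bsub>M\<^esub> b i)"
    unfolding coords_def by blast+
  show "i < n \<Longrightarrow> coords R M n b x i \<in> carrier R" using *(1) by (auto simp: PiE_iff)
  show "(\<Oplus>\<^bsub>M\<^esub>i\<in>{..<n}. coords R M n b x i \<odot>\<^bsub>M\<^esub> b i) = x" using *(2) by simp
qed

lemma mod_hom_finsum:
  assumes "Module.module R M" "Module.module R N" and f: "f \<in> mod_hom R M N"
    and "finite A" "g \<in> A \<rightarrow> carrier M"
  shows "f (\<Oplus>\<^bsub>M\<^esub>i\<in>A. g i) = (\<Oplus>\<^bsub>N\<^esub>i\<in>A. f (g i))"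
proof -
  interpret M: Module.module R M by fact
  interpret N: Module.module R N by fact
  show ?thesis
    using assms(4,5)
  proof (induction A)
    case empty
    \<comment> \<open>That \<open>f\<close> maps zero to zero follows by writing the zero of
      \<open>M\<close> as the zero scalar times itself.\<close>
    show ?case
      using mod_homD(3)[OF f M.R.zero_closed M.M.zero_closed] mod_homD(1)[OF f M.M.zero_closed]
      by simp
  next
    case (insert x A)
    then have "(\<lambda>i. f (g i)) \<in> A \<rightarrow> carrier N" using mod_homD(1)[OF f] by auto
    with insert show ?case by (simp add: Pi_iff mod_homD[OF f])
  qed
qed

lemma (in module) cayley_hamilton:
  assumes basis: "is_basis R M n b" and f: "f \<in> mod_hom R M M"
  shows "poly_at_endo R M (charpoly R n (rep_matrix R M n b f)) f = \<zero>\<^bsub>end_ring R M\<^esub>"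
proof -
  let ?E = "end_ring R M" and ?P = "UP R"
  \<comment> \<open>Scalars act as homotheties, which commute with every endomorphism by linearity;
    \<open>ev\<close> substitutes \<open>f\<close> for the indeterminate.\<close>
  define h where "h = (\<lambda>a. \<lambda>x\<in>carrier M. a \<odot>\<^bsub>M\<^esub> x)"
  define ev where "ev = eval R ?E h (restrict f (carrier M))"
  let ?m = "rep_matrix R M n b f"
  let ?X = "up_ring.monom ?P \<one>\<^bsub>R\<^esub> 1"
  \<comment> \<open>\<open>D\<close> is \<open>t I\<close> over the polynomial ring and
    \<open>T\<close> is \<open>t I - A\<close>, with the entries used in
    \<open>charpoly\<close>.\<close>
  define D where "D i j = (if i = j then ?X else \<zero>\<^bsub>?P\<^esub>)" for i j :: nat
  define T where "T i j = D i j \<ominus>\<^bsub>?P\<^esub> up_ring.monom ?P (?m i j) 0" for i j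
  interpret E: ring ?E by (rule ring_end_ring) (rule module_axioms)
  interpret P: UP_cring R ?P by unfold_locales simp
  have app: "\<zero>\<^bsub>?E\<^esub> x = \<zero>\<^bsub>M\<^esub>" "\<one>\<^bsub>?E\<^esub> x = x" "(u \<oplus>\<^bsub>?E\<^esub> v) x = u x \<oplus>\<^bsub>M\<^esub> v x"
    "(u \<otimes>\<^bsub>?E\<^esub> v) x = u (v x)" if "x \<in> carrier M" for u v x
    using that by (simp_all add: end_ring_def compose_def)
  have E: "u \<in> mod_hom R M M" if "u \<in> carrier ?E" for u
    using that by (simp add: end_ring_def)
  have eqI: "u = v" if "u \<in> carrier ?E" "v \<in> carrier ?E" "\<And>x. x \<in> carrier M \<Longrightarrow> u x = v x" for u v
    using that by (auto simp: end_ring_def intro: extensionalityI[of u "carrier M" v])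
  have h_closed: "h a \<in> carrier ?E" if "a \<in> carrier R" for a
    using that by (auto simp: h_def end_ring_def mod_hom_def smult_r_distr smult_assoc1[symmetric] R.m_comm)
  have h_app: "h a x = a \<odot>\<^bsub>M\<^esub> x" if "x \<in> carrier M" for a x
    using that by (simp add: h_def)
  have h: "h \<in> ring_hom R ?E"
    by (rule ring_hom_memI; (rule eqI)?) (simp_all add: h_closed app h_app smult_l_distr smult_assoc1)
  have s: "restrict f (carrier M) \<in> carrier ?E"
    using f by (auto simp: end_ring_def mod_hom_def)
  have central: "\<forall>a\<in>carrier R. \<forall>u\<in>carrier ?E. h a \<otimes>\<^bsub>?E\<^esub> u = u \<otimes>\<^bsub>?E\<^esub> h a"
    by (intro ballI eqI) (simp_all add: h_closed app h_app mod_homD[OF E])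
  note hom = eval_central_hom[OF R.is_cring E.ring_axioms h s central, folded ev_def]
  note evE = ring_hom_memE[OF hom(1)]
  have ev_app: "ev p x \<in> carrier M" if "p \<in> carrier ?P" "x \<in> carrier M" for p x
    using mod_homD(1)[OF E[OF evE(1)[OF that(1)]] that(2)] .
  \<comment> \<open>The group \<open>M\<close> becomes a module over the polynomial ring:
    \<open>p\<close> acts as the endomorphism \<open>ev p\<close>, so the indeterminate acts as
    \<open>f\<close>. The module axioms hold because \<open>ev\<close> is a ring homomorphism into
    the endomorphisms.\<close>
  define N where "N = \<lparr>carrier = carrier M, monoid.mult = monoid.mult M, monoid.one = monoid.one M,
    zero = \<zero>\<^bsub>M\<^esub>, add = add M, module.smult = ev\<rparr>"
  have N: "carrier N = carrier M" "zero N = zero M" "add N = add M" "module.smult N = ev"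
    by (simp_all add: N_def)
  have finsum_N: "finsum N = finsum M"
    by (intro ext) (simp add: N finsum_def finprod_def)
  have "Module.module ?P N"
  proof (rule moduleI)
    show "abelian_group N"
    proof (rule abelian_groupI)
      fix x assume "x \<in> carrier N"
      then show "\<exists>y\<in>carrier N. y \<oplus>\<^bsub>N\<^esub> x = \<zero>\<^bsub>N\<^esub>"
        using M.l_neg[of x] M.a_inv_closed[of x] by (auto simp: N)
    qed (simp_all add: N M.a_ac)
  qed (simp_all add: N P.P.is_cring ev_app evE app mod_homD[OF E[OF evE(1)]])
  then interpret N: Module.module ?P N .
  have b: "b i \<in> carrier M" if "i < n" for i
    using basis that by (auto simp: is_basis_def)
  have fb: "f (b j) \<in> carrier M" if "j < n" for j
    by (rule mod_homD(1)[OF f b[OF that]])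
  have m: "?m i j \<in> carrier R" if "i < n" "j < n" for i j
    unfolding rep_matrix_def by (rule coords_basis(1)[OF basis fb[OF that(2)] that(1)])
  have mon: "up_ring.monom ?P (?m i j) 0 \<in> carrier ?P" if "i < n" "j < n" for i j
    using m[OF that] by simp
  have D: "D i j \<in> carrier ?P" for i j by (simp add: D_def)
  have T: "T i j \<in> carrier ?P" if "i < n" "j < n" for i j
    using D mon[OF that] by (simp add: T_def)
  \<comment> \<open>The relation of column \<open>j\<close>: the indeterminate sends
    \<open>b j\<close> to \<open>f (b j)\<close>, which is also the combination of the basis with
    coefficients from column \<open>j\<close> of the matrix. To avoid subtraction,
    \<open>f (b j)\<close> is added to the sum in its expanded form and cancelled at the
    end.\<close>
  have rel: "(\<Oplus>\<^bsub>N\<^esub>i\<in>{..<n}. ev (T i j) (b i)) = \<zero>\<^bsub>N\<^esub>" if j: "j < n" for j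
  proof -
    have Tb: "ev (T i j) (b i) \<in> carrier M" if "i < n" for i
      using ev_app T[OF that j] b[OF that] by blast
    \<comment> \<open>Adding back the constant entry turns \<open>T i j\<close> into
      \<open>D i j\<close>, so only the diagonal term survives.\<close>
    have *: "ev (T i j) (b i) \<oplus>\<^bsub>M\<^esub> ?m i j \<odot>\<^bsub>M\<^esub> b i = (if j = i then f (b i) else \<zero>\<^bsub>M\<^esub>)"
      if i: "i < n" for i
    proof -
      have "T i j \<oplus>\<^bsub>?P\<^esub> up_ring.monom ?P (?m i j) 0 = D i j"
        using D mon[OF i j] by (simp add: T_def a_minus_def P.P.a_assoc P.P.l_neg)
      then have "ev (D i j) (b i) = ev (T i j) (b i) \<oplus>\<^bsub>M\<^esub> ev (up_ring.monom ?P (?m i j) 0) (b i)"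
        using evE(3)[OF T[OF i j] mon[OF i j]] app(3)[OF b[OF i]] by simp
      then have "ev (T i j) (b i) \<oplus>\<^bsub>M\<^esub> ?m i j \<odot>\<^bsub>M\<^esub> b i = ev (D i j) (b i)"
        using hom(3)[OF m[OF i j]] h_app[OF b[OF i]] by simp
      then show ?thesis
        using hom(2) b[OF i] N.smult_l_null[of "b i"] by (auto simp: D_def N)
    qed
    have "(\<Oplus>\<^bsub>M\<^esub>i\<in>{..<n}. ev (T i j) (b i)) \<oplus>\<^bsub>M\<^esub> f (b j) =
        (\<Oplus>\<^bsub>M\<^esub>i\<in>{..<n}. ev (T i j) (b i)) \<oplus>\<^bsub>M\<^esub> (\<Oplus>\<^bsub>M\<^esub>i\<in>{..<n}. ?m i j \<odot>\<^bsub>M\<^esub> b i)"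
      using coords_basis(2)[OF basis fb[OF j]] by (simp add: rep_matrix_def)
    also have "\<dots> = (\<Oplus>\<^bsub>M\<^esub>i\<in>{..<n}. ev (T i j) (b i) \<oplus>\<^bsub>M\<^esub> ?m i j \<odot>\<^bsub>M\<^esub> b i)"
      using Tb m j b by (intro M.finsum_addf[symmetric]) auto
    also have "\<dots> = (\<Oplus>\<^bsub>M\<^esub>i\<in>{..<n}. if j = i then f (b i) else \<zero>\<^bsub>M\<^esub>)"
      using * fb by (intro M.finsum_cong') auto
    also have "\<dots> = f (b j)"
      using j fb by (intro M.finsum_singleton) auto
    finally have "(\<Oplus>\<^bsub>M\<^esub>i\<in>{..<n}. ev (T i j) (b i)) = \<zero>\<^bsub>M\<^esub>"
      using fb[OF j] Tb M.add.r_cancel_one[of "f (b j)"] by (simp add: M.finsum_closed Pi_iff)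
    then show ?thesis by (simp add: finsum_N N)
  qed
  let ?p = "ring_det ?P n T"
  have p: "?p \<in> carrier ?P" by (rule P.P.ring_det_closed) (rule T)
  \<comment> \<open>The determinant trick is applied in \<open>N\<close>, where the scalar
    \<open>?p\<close> acts as \<open>ev ?p\<close>.\<close>
  have zero_b: "ev ?p (b k) = \<zero>\<^bsub>M\<^esub>" if "k < n" for k
    using N.ring_det_smult_eq_zero[of n T b k] T b rel that by (simp add: N)
  \<comment> \<open>The map \<open>ev ?p\<close> is linear over \<open>R\<close>, so its vanishing
    on the basis extends to every \<open>x\<close> through the coordinates of
    \<open>x\<close>.\<close>
  have "ev ?p = \<zero>\<^bsub>?E\<^esub>"
  proof (rule eqI[OF evE(1)[OF p] E.zero_closed])
    fix x assume x: "x \<in> carrier M"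
    let ?c = "coords R M n b x"
    note c = coords_basis[OF basis x]
    note ep = E[OF evE(1)[OF p]]
    have "ev ?p x = ev ?p (\<Oplus>\<^bsub>M\<^esub>i\<in>{..<n}. ?c i \<odot>\<^bsub>M\<^esub> b i)" by (simp add: c(2))
    also have "\<dots> = (\<Oplus>\<^bsub>M\<^esub>i\<in>{..<n}. ev ?p (?c i \<odot>\<^bsub>M\<^esub> b i))"
      using c(1) b by (intro mod_hom_finsum[OF module_axioms module_axioms ep]) auto
    also have "\<dots> = (\<Oplus>\<^bsub>M\<^esub>i\<in>{..<n}. \<zero>\<^bsub>M\<^esub>)"
      using c(1) b zero_b by (intro M.finsum_cong') (auto simp: mod_homD(3)[OF ep])
    finally show "ev ?p x = \<zero>\<^bsub>?E\<^esub> x" using x by (simp add: app)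
  qed
  moreover have "charpoly R n ?m = ?p"
    by (simp add: charpoly_def T_def[abs_def] D_def)
  ultimately show ?thesis
    by (simp add: poly_at_endo_def ev_def h_def)
qed

section \<open>Local gauges of a vector sheaf\<close>

theorem theorem4p1:
  fixes X :: "'x topology"
    and A :: "'x set \<Rightarrow> (complex, 'a) module"
    and \<rho> :: "'x set \<Rightarrow> 'x set \<Rightarrow> 'a \<Rightarrow> 'a"
    and E :: "'x set \<Rightarrow> ('a, 'e) module"
    and \<sigma> :: "'x set \<Rightarrow> 'x set \<Rightarrow> 'e \<Rightarrow> 'e"
    and n :: nat
    and \<phi> :: "'x set \<Rightarrow> 'e \<Rightarrow> 'e"
  assumes "sheaf_of_algebras X A \<rho>"
    and "vector_sheaf X A \<rho> E \<sigma> n"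
    and "sheaf_morphism X A E \<sigma> E \<sigma> \<phi>"
  shows "\<forall>U \<psi>. local_gauge X A \<rho> E \<sigma> n U \<longrightarrow> trivialization X A \<rho> E \<sigma> n U \<psi> \<longrightarrow>
    poly_at_endo (A U) (E U) (charpoly_gauge A E n \<phi> U \<psi>) (\<phi> U) = \<zero>\<^bsub>end_ring (A U) (E U)\<^esub>"
proof (intro allI impI)
  fix U \<psi>
  assume "local_gauge X A \<rho> E \<sigma> n U" and \<psi>: "trivialization X A \<rho> E \<sigma> n U \<psi>"
  then have U: "openin X U" by (simp add: local_gauge_def)
  interpret vector_sheaf X A \<rho> E \<sigma> n by fact
  have "\<phi> U \<in> mod_hom (A U) (E U) (E U)"
    using assms(3) U by (simp add: sheaf_morphism_def)
  \<comment> \<open>On a gauge the claim concerns the single module \<open>E U\<close>, for which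
    the trivialization provides the basis.\<close>
  then show "poly_at_endo (A U) (E U) (charpoly_gauge A E n \<phi> U \<psi>) (\<phi> U) = \<zero>\<^bsub>end_ring (A U) (E U)\<^esub>"
    unfolding charpoly_gauge_def
    by (rule module.cayley_hamilton[OF module_sections[OF U] is_basis_gauge_basis[OF U \<psi>]])
qed

end
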